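(* Let $\boldsymbol{x}=\{x_1,\dots,x_n\}$ be distinct points on the real line and let $\boldsymbol{\xi}=\{\xi_1,\dots,\xi_m\}\subset\mathbb{C}$ be closed under complex conjugation and solve the stationary relations $$-\sum_{j=1}^{n}\frac{1}{\xi_k-x_j}+\sum_{l\neq k}\frac{2}{\xi_k-\xi_l}=0,\qquad k=1,\dots,m.$$ Let $\boldsymbol{x}(t)$ and $\boldsymbol{\xi}(t)$ evolve according to the multiple chordal $\mathrm{SLE}(0)$ system with common parametrization of capacity ($\nu_j(t)=1$ for all $j$). Then: (i) The pair $(\boldsymbol{x}(t),\boldsymbol{\xi}(t))$ forms the closed dynamical system satisfying $$\dot x_j=2\Big(\sum_{k\neq j}\frac{2}{x_j-x_k}-\sum_{k=1}^m\frac{2}{x_j-\xi_k}\Big)$$ and $$\dot\xi_k=2\Big(-\sum_{l\neq k}\frac{2}{\xi_k-\xi_l}+\sum_{j=1}^n\frac{2}{\xi_k-x_j}\Big).$$ (ii) $\boldsymbol{x}(t)$ evolves according to the classical Calogero–Moser Hamiltonian, in other words $$\ddot x_j=-\sum_{k\neq j}\frac{8}{(x_j-x_k)^3}.$$ (iii) $\xi_k$ follows the second-order dynamics $$\ddot\xi_k=-\sum_{l\neq k}\frac{8}{(\xi_k-\xi_l)^3}.$$ (iv) The energy of the system is given by $\mathcal{H}(\boldsymbol{x},\boldsymbol{p})=0$.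
   Context: The multiple chordal $\mathrm{SLE}(0)$ system in the upper half-plane with marked point $\infty$ and common capacity parametrization is the Loewner flow $$\partial_tg_t(z)=\sum_{j=1}^n\frac{2}{g_t(z)-x_j(t)},\qquad g_0(z)=z,$$ with driving functions $$\dot x_j=\Big(\sum_{k\neq j}\frac{2}{x_j-x_k}-2\sum_{l=1}^m\frac{2}{x_j-\xi_l}\Big)+\sum_{k\neq j}\frac{2}{x_j-x_k},$$ and with the points $\xi_k$ following the flow, $\xi_k(t)=g_t(\xi_k(0))$; it is considered at times before any collision among the points $x_j(t)$, $\xi_k(t)$. The classical Calogero–Moser Hamiltonian is $$\mathcal{H}(\boldsymbol{x},\boldsymbol{p})=\sum_{j=1}^n\frac{p_j^2}{2}-\sum_{1\le j<k\le n}\frac{8}{(x_j-x_k)^2},$$ with Hamilton's equations $\dot x_j=\partial\mathcal{H}/\partial p_j$, $\dot p_j=-\partial\mathcal{H}/\partial x_j$, and $p_j=\dot x_j$.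
   Formalization: The constants 8 in (ii) and (iii) are corrected to 32, and the 8 in the Hamiltonian (used in (ii) and (iv)) to 16; with the stated flow the original constants fail, e.g. for n=2, m=0, where x_1''=-32/(x_1-x_2)^3 and the kinetic energy is 16/(x_1-x_2)^2. *)

theory Defs
  imports "HOL-Analysis.Analysis"
begin

text \<open>
  Particles carry the indices \<open>{1..n}\<close> and poles the indices \<open>{1..m}\<close>, so that \<open>m = 0\<close> is allowed.
  Everything evolves on a time interval \<open>[0,T)\<close>; derivatives are taken relative to that
  interval, hence are one-sided at time 0.
\<close>

definition stationary_relations ::
    "nat \<Rightarrow> nat \<Rightarrow> (nat \<Rightarrow> real) \<Rightarrow> (nat \<Rightarrow> complex) \<Rightarrow> bool" where
  "stationary_relations n m x \<xi> \<longleftrightarrow>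
     (\<forall>k\<in>{1..m}.
        - (\<Sum>j=1..n. 1 / (\<xi> k - complex_of_real (x j)))
        + (\<Sum>l\<in>{1..m} - {k}. 2 / (\<xi> k - \<xi> l)) = 0)"

definition collision_free ::
    "nat \<Rightarrow> nat \<Rightarrow> (nat \<Rightarrow> real) \<Rightarrow> (nat \<Rightarrow> complex) \<Rightarrow> bool" where
  "collision_free n m x \<xi> \<longleftrightarrow>
     inj_on x {1..n} \<and> inj_on \<xi> {1..m} \<and>
     (\<forall>j\<in>{1..n}. \<forall>k\<in>{1..m}. \<xi> k \<noteq> complex_of_real (x j))"

text \<open>
  \<open>w\<close> solves the Loewner equation on \<open>[0,S)\<close> from \<open>z\<close>. The point \<open>z\<close> ranges over the whole
  plane: the flow extends from the upper half-plane by the same equation, and the poles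
  occur in conjugate pairs or on the real line.
\<close>
definition loewner_solution ::
    "nat \<Rightarrow> (nat \<Rightarrow> real \<Rightarrow> real) \<Rightarrow> real \<Rightarrow> complex \<Rightarrow> (real \<Rightarrow> complex) \<Rightarrow> bool" where
  "loewner_solution n x S z w \<longleftrightarrow>
     w 0 = z \<and>
     (\<forall>t\<in>{0..<S}.
        (\<forall>j\<in>{1..n}. w t \<noteq> complex_of_real (x j t)) \<and>
        (w has_vector_derivative (\<Sum>j=1..n. 2 / (w t - complex_of_real (x j t))))
          (at t within {0..<S}))"

text \<open>
  \<open>g t z\<close> is prescribed exactly as long as \<open>z\<close> has not been swallowed, i.e. as long as some
  solution from \<open>z\<close> exists; afterwards its value is arbitrary.
\<close>
definition loewner_flow ::
    "nat \<Rightarrow> (nat \<Rightarrow> real \<Rightarrow> real) \<Rightarrow> real \<Rightarrow> (real \<Rightarrow> complex \<Rightarrow> complex) \<Rightarrow> bool" where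
  "loewner_flow n x T g \<longleftrightarrow>
     (\<forall>z S. 0 < S \<and> S \<le> T \<and> (\<exists>w. loewner_solution n x S z w)
        \<longrightarrow> loewner_solution n x S z (\<lambda>t. g t z))"

text \<open>
  The driving equation is stated in the complex numbers, its right-hand side being
  complex as written. The clause on existence of a Loewner solution
  says that no pole is swallowed before time \<open>T\<close>.
\<close>
definition multiple_chordal_SLE0 ::
    "nat \<Rightarrow> nat \<Rightarrow> real \<Rightarrow> (nat \<Rightarrow> real) \<Rightarrow> (nat \<Rightarrow> complex) \<Rightarrow> (real \<Rightarrow> complex \<Rightarrow> complex)
      \<Rightarrow> (nat \<Rightarrow> real \<Rightarrow> real) \<Rightarrow> (nat \<Rightarrow> real \<Rightarrow> complex) \<Rightarrow> bool" where
  "multiple_chordal_SLE0 n m T x0 \<xi>0 g x \<xi> \<longleftrightarrow>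
     (\<forall>j\<in>{1..n}. x j 0 = x0 j) \<and>
     loewner_flow n x T g \<and>
     (\<forall>k\<in>{1..m}. \<exists>w. loewner_solution n x T (\<xi>0 k) w) \<and>
     (\<forall>k\<in>{1..m}. \<forall>t\<in>{0..<T}. \<xi> k t = g t (\<xi>0 k)) \<and>
     (\<forall>t\<in>{0..<T}. collision_free n m (\<lambda>j. x j t) (\<lambda>k. \<xi> k t)) \<and>
     (\<forall>j\<in>{1..n}. \<forall>t\<in>{0..<T}.
        ((\<lambda>s. complex_of_real (x j s)) has_vector_derivative
          (((\<Sum>k\<in>{1..n} - {j}. 2 / complex_of_real (x j t - x k t))
             - 2 * (\<Sum>l=1..m. 2 / (complex_of_real (x j t) - \<xi> l t)))
           + (\<Sum>k\<in>{1..n} - {j}. 2 / complex_of_real (x j t - x k t))))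
          (at t within {0..<T}))"

abbreviation time_derivative :: "real \<Rightarrow> (real \<Rightarrow> 'a::real_normed_vector) \<Rightarrow> real \<Rightarrow> 'a" where
  "time_derivative T f t \<equiv> vector_derivative f (at t within {0..<T})"

text \<open>
  The coupling 16 is tied to the normalisation of the flow. For two particles and no pole,
  with \<open>d = x\<^sub>1 - x\<^sub>2\<close>, the momenta are \<open>4/d\<close> and \<open>-4/d\<close> and the kinetic energy is \<open>16/d\<^sup>2\<close>;
  moreover \<open>d' = 8/d\<close>, so that \<open>x\<^sub>1'' = -32/d\<^sup>3\<close>, which is the force of the potential \<open>-16/d\<^sup>2\<close>.
\<close>
definition calogero_moser_hamiltonian :: "nat \<Rightarrow> (nat \<Rightarrow> real) \<Rightarrow> (nat \<Rightarrow> real) \<Rightarrow> real" where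
  "calogero_moser_hamiltonian n x p =
     (\<Sum>j=1..n. (p j)\<^sup>2 / 2) - (\<Sum>j=1..n. \<Sum>k\<in>{j<..n}. 16 / (x j - x k)\<^sup>2)"

text \<open>
  Hamilton's equations on \<open>[0,T)\<close> for coordinates \<open>x j\<close> and momenta \<open>p j\<close>; \<open>a\<close> and \<open>b\<close> are the
  partial derivatives of \<open>H\<close> in the \<open>j\<close>-th momentum and coordinate, required to exist.
\<close>
definition hamilton_equations ::
    "((nat \<Rightarrow> real) \<Rightarrow> (nat \<Rightarrow> real) \<Rightarrow> real) \<Rightarrow> nat \<Rightarrow> real
      \<Rightarrow> (nat \<Rightarrow> real \<Rightarrow> real) \<Rightarrow> (nat \<Rightarrow> real \<Rightarrow> real) \<Rightarrow> bool" where
  "hamilton_equations H n T x p \<longleftrightarrow>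
     (\<forall>j\<in>{1..n}. \<forall>t\<in>{0..<T}. \<exists>a b.
        ((\<lambda>s. H (\<lambda>i. x i t) ((\<lambda>i. p i t)(j := s))) has_real_derivative a) (at (p j t)) \<and>
        ((\<lambda>s. H ((\<lambda>i. x i t)(j := s)) (\<lambda>i. p i t)) has_real_derivative b) (at (x j t)) \<and>
        (x j has_vector_derivative a) (at t within {0..<T}) \<and>
        (p j has_vector_derivative - b) (at t within {0..<T}))"

end

theory Submission imports Defs begin

text \<open>
  Give the particles \<open>x j\<close> charge \<open>+1\<close> and the poles \<open>\<xi> k\<close> charge \<open>-1\<close>. The closed system in (i) then reads
  \<open>z' a = 4 (\<Sum>b\<noteq>a. q b / (z a - z b))\<close> for all points alike. Differentiating once more and cancelling the
  three-body terms by antisymmetry leaves the force \<open>-16 (\<Sum>b\<noteq>a. q b (q a + q b) / (z a - z b)^3)\<close>, in which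
  only points of equal charge interact: this is (ii) and (iii) at once.

  The Loewner flow gives \<open>\<xi>' k = 2 A k\<close> with \<open>A k = (\<Sum>j. 1 / (\<xi> k - x j))\<close>; it agrees with the closed system
  because the defect \<open>s k\<close> of the \<open>k\<close>-th stationary relation satisfies the linear equation
  \<open>s' k = 2 (\<Sum>j. 1 / (\<xi> k - x j)^2) s k\<close> and vanishes at time 0.

  For the energy, \<open>\<Sum>a. q a (\<Sum>b\<noteq>a. q b / (z a - z b))^2\<close> equals \<open>\<Sum>a\<noteq>b. q a / (z a - z b)^2\<close>; its
  particle-pole terms cancel, and its pole part cancels against the same identity for the poles alone, because
  stationarity turns the field at a pole into \<open>\<Sum>l\<noteq>k. 1 / (\<xi> k - \<xi> l)\<close>.
\<close>

section \<open>Auxiliary facts: sums over ordered pairs of distinct indices, and a quotient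
  derivative\<close>

lemma sum_off_diagonal_swap:
  assumes "finite A"
  shows "(\<Sum>b\<in>A. \<Sum>c\<in>A - {b}. f b c) = (\<Sum>b\<in>A. \<Sum>c\<in>A - {b}. f c b)"
proof -
  have "A - {b} = {c\<in>A. c \<noteq> b}" "A - {b} = {c\<in>A. b \<noteq> c}" for b by auto
  then show ?thesis
    using sum.swap_restrict[OF assms assms, of f "\<lambda>b c. b \<noteq> c"] by simp
qed

text \<open>Adding the transposed copy doubles the sum and makes every summand vanish;
  characteristic zero allows division by 2.\<close>

lemma sum_off_diagonal_antisym:
  fixes f :: "'i \<Rightarrow> 'i \<Rightarrow> 'a :: field_char_0"
  assumes "finite A" "\<And>b c. \<lbrakk>b \<in> A; c \<in> A; b \<noteq> c\<rbrakk> \<Longrightarrow> f b c + f c b = 0"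
  shows "(\<Sum>b\<in>A. \<Sum>c\<in>A - {b}. f b c) = 0"
proof -
  have "2 * (\<Sum>b\<in>A. \<Sum>c\<in>A - {b}. f b c) = (\<Sum>b\<in>A. \<Sum>c\<in>A - {b}. f b c + f c b)"
    by (simp only: sum.distrib mult_2 sum_off_diagonal_swap[OF assms(1), of "\<lambda>b c. f c b"])
  also have "\<dots> = 0"
    using assms(2) by (intro sum.neutral ballI) auto
  finally show ?thesis by simp
qed

lemma has_vector_derivative_const_divide:
  fixes f :: "real \<Rightarrow> 'a :: real_normed_field"
  assumes "(f has_vector_derivative f') (at t within S)" "f t \<noteq> 0"
  shows "((\<lambda>s. c / f s) has_vector_derivative - (c * f' / (f t)\<^sup>2)) (at t within S)"
proof -
  have "((\<lambda>z. c / z) has_field_derivative - (c / (f t)\<^sup>2)) (at (f t))"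
    using assms(2) by (auto intro!: derivative_eq_intros simp: power2_eq_square)
  from field_vector_diff_chain_within[OF assms(1) DERIV_subset[OF this subset_UNIV]]
  show ?thesis by (simp add: o_def mult.commute)
qed

section \<open>Algebraic identities for the field of a logarithmic gas\<close>

definition log_gas_field :: "'i set \<Rightarrow> ('i \<Rightarrow> 'a) \<Rightarrow> ('i \<Rightarrow> 'a :: field) \<Rightarrow> 'i \<Rightarrow> 'a" where
  "log_gas_field I q z a = (\<Sum>b\<in>I - {a}. q b / (z a - z b))"

text \<open>The mutual terms of \<open>a\<close> and \<open>b\<close> combine into
  \<open>(q a + q b) / (z a - z b)\<close>. For a third point, a difference of two fractions
  produces the factor \<open>z a - z b\<close>, which later lowers the order of the pole.\<close>

lemma log_gas_field_diff:
  assumes I: "finite I" "inj_on z I" and ab: "a \<in> I" "b \<in> I" "a \<noteq> b"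
  shows "log_gas_field I q z a - log_gas_field I q z b =
    (q a + q b) / (z a - z b)
      - (\<Sum>c\<in>I - {a} - {b}. q c * (z a - z b) / ((z a - z c) * (z b - z c)))"
proof -
  have ne: "z i \<noteq> z j" if "i \<in> I" "j \<in> I" "i \<noteq> j" for i j
    using I(2) that by (auto simp: inj_on_def)
  have sets: "I - {b} - {a} = I - {a} - {b}" by auto
  have "log_gas_field I q z a = q b / (z a - z b) + (\<Sum>c\<in>I - {a} - {b}. q c / (z a - z c))"
    unfolding log_gas_field_def using I ab by (subst sum.remove[of _ b]) auto
  moreover have "log_gas_field I q z b = q a / (z b - z a) + (\<Sum>c\<in>I - {a} - {b}. q c / (z b - z c))"
    unfolding log_gas_field_def sets[symmetric] using I ab by (subst sum.remove[of _ a]) auto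
  moreover have "(\<Sum>c\<in>I - {a} - {b}. q c / (z a - z c)) - (\<Sum>c\<in>I - {a} - {b}. q c / (z b - z c))
      = - (\<Sum>c\<in>I - {a} - {b}. q c * (z a - z b) / ((z a - z c) * (z b - z c)))"
    unfolding sum_subtractf[symmetric] sum_negf[symmetric]
  proof (intro sum.cong refl)
    fix c assume "c \<in> I - {a} - {b}"
    then have "z a \<noteq> z c" "z b \<noteq> z c" using ne ab by auto
    then show "q c / (z a - z c) - q c / (z b - z c) = - (q c * (z a - z b) / ((z a - z c) * (z b - z c)))"
      by (simp add: divide_simps) (simp add: algebra_simps)
  qed
  moreover have "q a / (z b - z a) = - (q a / (z a - z b))"
    by (metis minus_diff_eq minus_divide_right)
  ultimately show ?thesis by (simp add: add_divide_distrib)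
qed

text \<open>When velocities are proportional to the field, this sum is, up to a constant factor, the
  time derivative of the field at \<open>a\<close>. By \<open>log_gas_field_diff\<close> each
  summand is a two-body term minus three-body terms \<open>h b c\<close>; swapping \<open>b\<close>
  and \<open>c\<close> flips only the sign of \<open>z b - z c\<close> in \<open>h\<close>, so these
  cancel in the double sum.\<close>

lemma log_gas_force:
  fixes z :: "'i \<Rightarrow> 'a :: field_char_0"
  assumes I: "finite I" "inj_on z I" and a: "a \<in> I"
  shows "(\<Sum>b\<in>I - {a}. q b * (log_gas_field I q z a - log_gas_field I q z b) / (z a - z b)\<^sup>2)
    = (\<Sum>b\<in>I - {a}. q b * (q a + q b) / (z a - z b) ^ 3)"
proof -
  have ne: "z i \<noteq> z j" if "i \<in> I" "j \<in> I" "i \<noteq> j" for i j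
    using I(2) that by (auto simp: inj_on_def)
  define h where "h b c = q b * q c / ((z a - z b) * (z a - z c) * (z b - z c))" for b c
  have eq: "q b * (log_gas_field I q z a - log_gas_field I q z b) / (z a - z b)\<^sup>2
      = q b * (q a + q b) / (z a - z b) ^ 3 - (\<Sum>c\<in>I - {a} - {b}. h b c)"
    if b: "b \<in> I - {a}" for b
  proof -
    have zab: "z a - z b \<noteq> 0" using ne a b by auto
    have "q b * (log_gas_field I q z a - log_gas_field I q z b) / (z a - z b)\<^sup>2
      = q b / (z a - z b)\<^sup>2 * ((q a + q b) / (z a - z b))
        - (\<Sum>c\<in>I - {a} - {b}. q b / (z a - z b)\<^sup>2 * (q c * (z a - z b) / ((z a - z c) * (z b - z c))))"
      using log_gas_field_diff[OF I a, of b q] b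
      by (simp only: sum_distrib_left[symmetric] right_diff_distrib[symmetric]) auto
    also have "q b / (z a - z b)\<^sup>2 * ((q a + q b) / (z a - z b)) = q b * (q a + q b) / (z a - z b) ^ 3"
      by (simp add: power2_eq_square power3_eq_cube)
    also have "(\<Sum>c\<in>I - {a} - {b}. q b / (z a - z b)\<^sup>2 * (q c * (z a - z b) / ((z a - z c) * (z b - z c))))
      = (\<Sum>c\<in>I - {a} - {b}. h b c)"
      using zab by (intro sum.cong refl) (auto simp: h_def power2_eq_square)
    finally show ?thesis .
  qed
  have "(\<Sum>b\<in>I - {a}. \<Sum>c\<in>I - {a} - {b}. h b c) = 0"
  proof (rule sum_off_diagonal_antisym)
    show "h b c + h c b = 0" for b c
    proof -
      have "h c b = q c * q b / ((z a - z c) * (z a - z b) * - (z b - z c))"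
        by (simp add: h_def)
      also have "\<dots> = - h b c"
        unfolding h_def mult_minus_right divide_minus_right by (simp add: mult_ac)
      finally show ?thesis by simp
    qed
  qed (use I in simp)
  then show ?thesis by (simp add: eq sum_subtractf)
qed

text \<open>Expanding the square, the diagonal terms give the right-hand side. The remaining terms
  run over three distinct points and cancel because
  \<open>1/((a-b)(a-c)) + 1/((b-a)(b-c)) + 1/((c-a)(c-b)) = 0\<close>.\<close>

lemma log_gas_energy:
  fixes z :: "'i \<Rightarrow> 'a :: field_char_0"
  assumes I: "finite I" "inj_on z I"
  shows "(\<Sum>a\<in>I. q a * (log_gas_field I q z a)\<^sup>2) = (\<Sum>a\<in>I. \<Sum>b\<in>I - {a}. q a * (q b)\<^sup>2 / (z a - z b)\<^sup>2)"
proof -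
  \<comment> \<open>Extending by zero to coinciding indices lets all three sums range over the whole
    of \<open>I\<close>, so that they can be permuted freely.\<close>
  define f where "f a b c = (if a \<noteq> b \<and> b \<noteq> c \<and> a \<noteq> c
    then q a * q b * q c / ((z a - z b) * (z a - z c)) else 0)" for a b c
  have f0: "f a b c + f b a c + f c b a = 0" if "a \<in> I" "b \<in> I" "c \<in> I" for a b c
  proof (cases "a \<noteq> b \<and> b \<noteq> c \<and> a \<noteq> c")
    case True
    then have "z a \<noteq> z b" "z b \<noteq> z c" "z a \<noteq> z c" using I(2) that by (auto simp: inj_on_def)
    then have "1 / ((z a - z b) * (z a - z c)) + 1 / ((z b - z a) * (z b - z c))
      + 1 / ((z c - z b) * (z c - z a)) = 0"
      by (simp add: divide_simps) (simp add: algebra_simps)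
    then have "q a * q b * q c * (1 / ((z a - z b) * (z a - z c)) + 1 / ((z b - z a) * (z b - z c))
      + 1 / ((z c - z b) * (z c - z a))) = 0" by simp
    with True show ?thesis by (auto simp: f_def distrib_left mult_ac)
  qed (auto simp: f_def)
  let ?S = "\<lambda>f. \<Sum>a\<in>I. \<Sum>b\<in>I. \<Sum>c\<in>I. f a b c"
  have 1: "?S f = ?S (\<lambda>a b c. f b a c)"
    by (rule sum.swap)
  have "?S f = (\<Sum>b\<in>I. \<Sum>c\<in>I. \<Sum>a\<in>I. f a b c)"
    unfolding 1 by (intro sum.cong refl sum.swap)
  also have "\<dots> = (\<Sum>c\<in>I. \<Sum>b\<in>I. \<Sum>a\<in>I. f a b c)"
    by (rule sum.swap)
  finally have 2: "?S f = ?S (\<lambda>a b c. f c b a)" .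
  \<comment> \<open>The three copies put each of the three points once into the distinguished first
    slot, which is what \<open>f0\<close> needs.\<close>
  have "3 * ?S f = ?S f + ?S (\<lambda>a b c. f b a c) + ?S (\<lambda>a b c. f c b a)"
    unfolding 1[symmetric] 2[symmetric] by simp
  also have "\<dots> = ?S (\<lambda>a b c. f a b c + f b a c + f c b a)"
    by (simp add: sum.distrib)
  also have "\<dots> = 0" using f0 by simp
  finally have triple: "(\<Sum>a\<in>I. \<Sum>b\<in>I. \<Sum>c\<in>I. f a b c) = 0" by simp
  have "q a * (log_gas_field I q z a)\<^sup>2 =
      (\<Sum>b\<in>I - {a}. q a * (q b)\<^sup>2 / (z a - z b)\<^sup>2) + (\<Sum>b\<in>I. \<Sum>c\<in>I. f a b c)"
    if a: "a \<in> I" for a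
  proof -
    define u where "u b = q b / (z a - z b)" for b
    have "q a * (log_gas_field I q z a)\<^sup>2 = (\<Sum>b\<in>I - {a}. q a * u b * (\<Sum>c\<in>I - {a}. u c))"
      unfolding log_gas_field_def u_def[symmetric] power2_eq_square
      by (simp add: sum_distrib_left[symmetric] sum_distrib_right[symmetric])
    also have "\<dots> = (\<Sum>b\<in>I - {a}. q a * (u b)\<^sup>2 + (\<Sum>c\<in>I. f a b c))"
    proof (intro sum.cong refl)
      fix b assume b: "b \<in> I - {a}"
      have "(\<Sum>c\<in>I. f a b c) = (\<Sum>c\<in>I - {a} - {b}. q a * u b * u c)"
        using b I by (intro sum.mono_neutral_cong_right) (auto simp: f_def u_def)
      moreover have "(\<Sum>c\<in>I - {a}. u c) = u b + (\<Sum>c\<in>I - {a} - {b}. u c)"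
        using b I by (intro sum.remove) auto
      ultimately show "q a * u b * (\<Sum>c\<in>I - {a}. u c) = q a * (u b)\<^sup>2 + (\<Sum>c\<in>I. f a b c)"
        by (simp add: sum_distrib_left[symmetric] power2_eq_square distrib_left)
    qed
    also have "\<dots> = (\<Sum>b\<in>I - {a}. q a * (u b)\<^sup>2) + (\<Sum>b\<in>I. \<Sum>c\<in>I. f a b c)"
      using I by (simp add: sum.distrib, intro sum.mono_neutral_left) (auto simp: f_def)
    finally show ?thesis by (simp add: u_def power_divide)
  qed
  then show ?thesis by (simp add: sum.distrib triple)
qed

section \<open>Differential equations: uniqueness for a linear equation, and the second-order law of
  the gas\<close>

lemma linear_ode_zero:
  fixes s c :: "real \<Rightarrow> complex"
  assumes c: "continuous_on {0..<T} c"
    and s: "\<And>t. t \<in> {0..<T} \<Longrightarrow> (s has_vector_derivative c t * s t) (at t within {0..<T})"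
    and "s 0 = 0" and t: "t \<in> {0..<T}"
  shows "s t = 0"
proof -
  \<comment> \<open>The integrating factor is \<open>exp (- E u)\<close>. Working on the compact
    interval [0,t] secures the integral, since \<open>c\<close> may blow up at
    \<open>T\<close>.\<close>
  define E where "E u = integral {0..u} c" for u
  have sub: "{0..t} \<subseteq> {0..<T}" using t by auto
  have E: "(E has_vector_derivative c u) (at u within {0..t})" if "u \<in> {0..t}" for u
    unfolding E_def by (rule integral_has_vector_derivative[OF continuous_on_subset[OF c sub] that])
  have "((\<lambda>u. s u * exp (- E u)) has_vector_derivative 0) (at u within {0..t})" if u: "u \<in> {0..t}" for u
  proof -
    have 1: "(s has_vector_derivative c u * s u) (at u within {0..t})"
      using has_vector_derivative_within_subset[OF s sub] u sub by auto
    have 2: "(exp \<circ> (\<lambda>u. - E u) has_vector_derivative - c u * exp (- E u)) (at u within {0..t})"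
      by (rule field_vector_diff_chain_within[OF has_vector_derivative_minus[OF E[OF u]]])
         (rule DERIV_subset[OF DERIV_exp subset_UNIV])
    show ?thesis
      using has_vector_derivative_mult[OF 1 2] by (simp add: o_def algebra_simps)
  qed
  then obtain k where k: "\<And>u. u \<in> {0..t} \<Longrightarrow> s u * exp (- E u) = k"
    using has_vector_derivative_zero_constant[of "{0..t}" "\<lambda>u. s u * exp (- E u)"] by auto
  from k[of 0] k[of t] t \<open>s 0 = 0\<close> show ?thesis by simp
qed

text \<open>Differentiating the field brings in velocity differences \<open>4 * (F a - F b)\<close>,
  to which \<open>log_gas_force\<close> applies; the two factors 4 give 16.\<close>

lemma log_gas_second_order:
  fixes z :: "'i \<Rightarrow> real \<Rightarrow> 'a :: real_normed_field"
  assumes I: "finite I" "\<And>t. t \<in> S \<Longrightarrow> inj_on (\<lambda>i. z i t) I"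
    and dz: "\<And>i t. i \<in> I \<Longrightarrow> t \<in> S \<Longrightarrow>
      (z i has_vector_derivative 4 * log_gas_field I q (\<lambda>i. z i t) i) (at t within S)"
    and q: "\<And>i. i \<in> I \<Longrightarrow> q i = 1 \<or> q i = -1"
    and a: "a \<in> I" and t: "t \<in> S"
  shows "((\<lambda>s. 4 * log_gas_field I q (\<lambda>i. z i s) a) has_vector_derivative
    - (\<Sum>b\<in>{b \<in> I - {a}. q b = q a}. 32 / (z a t - z b t) ^ 3)) (at t within S)"
proof -
  define F where "F = log_gas_field I q (\<lambda>i. z i t)"
  have dzt: "(z i has_vector_derivative 4 * F i) (at t within S)" if "i \<in> I" for i
    unfolding F_def by (rule dz[OF that t])
  have "((\<lambda>s. log_gas_field I q (\<lambda>i. z i s) a) has_vector_derivative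
      (\<Sum>b\<in>I - {a}. - (q b * (4 * F a - 4 * F b) / (z a t - z b t)\<^sup>2))) (at t within S)"
    unfolding log_gas_field_def
  proof (intro has_vector_derivative_sum has_vector_derivative_const_divide
      has_vector_derivative_diff dzt a)
    fix b assume "b \<in> I - {a}"
    then show "b \<in> I" "z a t - z b t \<noteq> 0"
      using I(2)[OF t] a by (auto simp: inj_on_def)
  qed
  then have "((\<lambda>s. 4 * log_gas_field I q (\<lambda>i. z i s) a) has_vector_derivative
      4 * (\<Sum>b\<in>I - {a}. - (q b * (4 * F a - 4 * F b) / (z a t - z b t)\<^sup>2))) (at t within S)"
    by (rule bounded_linear.has_vector_derivative[OF bounded_linear_mult_right])
  also have "4 * (\<Sum>b\<in>I - {a}. - (q b * (4 * F a - 4 * F b) / (z a t - z b t)\<^sup>2))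
      = - 16 * (\<Sum>b\<in>I - {a}. q b * (F a - F b) / (z a t - z b t)\<^sup>2)"
    unfolding sum_distrib_left by (intro sum.cong refl) (simp add: algebra_simps diff_divide_distrib)
  also have "\<dots> = - 16 * (\<Sum>b\<in>I - {a}. q b * (q a + q b) / (z a t - z b t) ^ 3)"
    unfolding F_def by (subst log_gas_force[OF I(1) I(2)[OF t] a]) simp
  \<comment> \<open>For charges 1 and -1 the product \<open>q b * (q a + q b)\<close> is 2 if they
    agree and 0 otherwise, whence 32 = 16 * 2.\<close>
  also have "\<dots> = - (\<Sum>b\<in>I - {a}. if q b = q a then 32 / (z a t - z b t) ^ 3 else 0)"
    unfolding sum_distrib_left sum_negf[symmetric]
  proof (intro sum.cong refl)
    fix b assume "b \<in> I - {a}"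
    with q[of a] q[of b] a show "- 16 * (q b * (q a + q b) / (z a t - z b t) ^ 3) =
        - (if q b = q a then 32 / (z a t - z b t) ^ 3 else 0)" by auto
  qed
  also have "\<dots> = - (\<Sum>b\<in>{b \<in> I - {a}. q b = q a}. 32 / (z a t - z b t) ^ 3)"
    using I(1) by (simp only: sum.inter_filter finite_Diff)
  finally show ?thesis .
qed

section \<open>Particles and poles as one gas on a disjoint union, and the role of
  stationarity\<close>

definition signed_charge :: "'i + 'k \<Rightarrow> 'a :: field" where
  "signed_charge = case_sum (\<lambda>_. 1) (\<lambda>_. - 1)"

lemma signed_charge_simps [simp]: "signed_charge (Inl j) = 1" "signed_charge (Inr k) = - 1"
  by (simp_all add: signed_charge_def)

lemma Plus_diff_singleton:
  "(J <+> M) - {Inl j} = (J - {j}) <+> M" "(J <+> M) - {Inr k} = J <+> (M - {k})"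
  by auto

lemma log_gas_field_signed:
  assumes "finite J" "finite M"
  shows "log_gas_field (J <+> M) signed_charge (case_sum x y) (Inl j) =
      (\<Sum>i\<in>J - {j}. 1 / (x j - x i)) - (\<Sum>l\<in>M. 1 / (x j - y l))"
    and "log_gas_field (J <+> M) signed_charge (case_sum x y) (Inr k) =
      (\<Sum>j\<in>J. 1 / (y k - x j)) - (\<Sum>l\<in>M - {k}. 1 / (y k - y l))"
  using assms by (simp_all add: log_gas_field_def Plus_diff_singleton sum.Plus o_def sum_negf)

lemma inj_on_case_sum_Plus:
  assumes "inj_on x J" "inj_on y M" "\<And>j k. j \<in> J \<Longrightarrow> k \<in> M \<Longrightarrow> y k \<noteq> x j"
  shows "inj_on (case_sum x y) (J <+> M)"
  using assms by (fastforce simp: inj_on_def)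

text \<open>With particle velocities equal to 4 times the field, this identity expresses the kinetic
  energy by pair interactions alone. The identity for the whole gas reads \<open>X - Y\<close> on
  the left, and \<open>Y\<close> occurs again on the right as the pole-pole sum.\<close>

lemma stationary_energy:
  fixes x :: "'i \<Rightarrow> 'a :: field_char_0" and y :: "'k \<Rightarrow> 'a"
  assumes fin: "finite J" "finite M"
    and inj: "inj_on x J" "inj_on y M" "\<And>j k. j \<in> J \<Longrightarrow> k \<in> M \<Longrightarrow> y k \<noteq> x j"
    and stat: "\<And>k. k \<in> M \<Longrightarrow> (\<Sum>j\<in>J. 1 / (y k - x j)) = 2 * (\<Sum>l\<in>M - {k}. 1 / (y k - y l))"
  shows "(\<Sum>j\<in>J. ((\<Sum>i\<in>J - {j}. 1 / (x j - x i)) - (\<Sum>l\<in>M. 1 / (x j - y l)))\<^sup>2)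
    = (\<Sum>j\<in>J. \<Sum>i\<in>J - {j}. 1 / (x j - x i)\<^sup>2)"
proof -
  define X where "X = (\<Sum>j\<in>J. ((\<Sum>i\<in>J - {j}. 1 / (x j - x i)) - (\<Sum>l\<in>M. 1 / (x j - y l)))\<^sup>2)"
  define Y where "Y = (\<Sum>k\<in>M. (\<Sum>l\<in>M - {k}. 1 / (y k - y l))\<^sup>2)"
  have Y: "Y = (\<Sum>k\<in>M. \<Sum>l\<in>M - {k}. 1 / (y k - y l)\<^sup>2)"
    using log_gas_energy[OF fin(2) inj(2), of "\<lambda>_. 1"] by (simp add: Y_def log_gas_field_def)
  have "(\<Sum>k\<in>M. (log_gas_field (J <+> M) signed_charge (case_sum x y) (Inr k))\<^sup>2) = Y"
    unfolding Y_def log_gas_field_signed[OF fin]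
    by (intro sum.cong refl) (simp add: stat)
  moreover have "(\<Sum>j\<in>J. (log_gas_field (J <+> M) signed_charge (case_sum x y) (Inl j))\<^sup>2) = X"
    unfolding X_def log_gas_field_signed[OF fin] ..
  moreover have "(\<Sum>k\<in>M. \<Sum>j\<in>J. 1 / (y k - x j)\<^sup>2) = (\<Sum>j\<in>J. \<Sum>k\<in>M. 1 / (x j - y k)\<^sup>2)"
    by (subst sum.swap) (simp add: power2_commute)
  ultimately have "X - Y = (\<Sum>j\<in>J. \<Sum>i\<in>J - {j}. 1 / (x j - x i)\<^sup>2) - Y"
    using log_gas_energy[OF finite_Plus[OF fin] inj_on_case_sum_Plus[OF inj], of signed_charge] fin
    by (simp add: Plus_diff_singleton sum.Plus o_def sum_negf sum.distrib sum_subtractf Y)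
  then show ?thesis by (simp add: X_def)
qed

text \<open>If poles move with velocity \<open>2 * A k\<close> and particles with
  \<open>v j\<close>, the left-hand side is the time derivative of the \<open>k\<close>-th
  stationarity defect. Stationarity is not assumed, so the result is a linear equation for the
  defect. Everything is reduced to \<open>P\<close>, \<open>Q\<close>, \<open>R\<close>,
  \<open>B\<close> and \<open>A k\<close>, and the terms in \<open>Q\<close> and \<open>R\<close>
  cancel.\<close>

lemma stationary_drift:
  fixes x :: "'i \<Rightarrow> 'a :: field_char_0" and y :: "'k \<Rightarrow> 'a" and J :: "'i set" and M :: "'k set"
  defines "A \<equiv> \<lambda>k. \<Sum>j\<in>J. 1 / (y k - x j)"
  defines "v \<equiv> \<lambda>j. 4 * ((\<Sum>i\<in>J - {j}. 1 / (x j - x i)) - (\<Sum>l\<in>M. 1 / (x j - y l)))"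
  assumes fin: "finite J" "finite M" and k: "k \<in> M"
    and inj: "inj_on x J" "inj_on y M" "\<And>j k. j \<in> J \<Longrightarrow> k \<in> M \<Longrightarrow> y k \<noteq> x j"
  shows "(\<Sum>j\<in>J. (2 * A k - v j) / (y k - x j)\<^sup>2)
      - (\<Sum>l\<in>M - {k}. 2 * (2 * A k - 2 * A l) / (y k - y l)\<^sup>2)
    = 2 * (\<Sum>j\<in>J. 1 / (y k - x j)\<^sup>2) * (- A k + (\<Sum>l\<in>M - {k}. 2 / (y k - y l)))"
proof -
  define a where "a j = 1 / (y k - x j)" for j
  define b where "b l = 1 / (y k - y l)" for l
  define P where "P = (\<Sum>j\<in>J. (a j)\<^sup>2)"
  define Q where "Q = (\<Sum>j\<in>J. (a j) ^ 3)"
  define R where "R = (\<Sum>l\<in>M - {k}. (b l)\<^sup>2 * (A l - A k))"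
  define B where "B = (\<Sum>l\<in>M - {k}. b l)"
  \<comment> \<open>Since \<open>a j - a i = (x j - x i) * a i * a j\<close>, the terms
    \<open>(a j)^2 / (x j - x i)\<close> and \<open>(a j)^2 * a i\<close> agree after symmetrisation
    in \<open>i\<close> and \<open>j\<close>.\<close>
  have xx: "(\<Sum>j\<in>J. (a j)\<^sup>2 * (\<Sum>i\<in>J - {j}. 1 / (x j - x i))) = A k * P - Q"
  proof -
    have "(\<Sum>j\<in>J. \<Sum>i\<in>J - {j}. (a j)\<^sup>2 / (x j - x i) - (a j)\<^sup>2 * a i) = 0"
    proof (rule sum_off_diagonal_antisym[OF fin(1)])
      fix i j assume "i \<in> J" "j \<in> J" "i \<noteq> j"
      then have "x i \<noteq> x j" "y k \<noteq> x i" "y k \<noteq> x j" using inj k by (auto simp: inj_on_def)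
      then show "(a i)\<^sup>2 / (x i - x j) - (a i)\<^sup>2 * a j + ((a j)\<^sup>2 / (x j - x i) - (a j)\<^sup>2 * a i) = 0"
        unfolding a_def by (simp add: divide_simps) (simp add: power2_eq_square algebra_simps)
    qed
    then have "(\<Sum>j\<in>J. (a j)\<^sup>2 * (\<Sum>i\<in>J - {j}. 1 / (x j - x i))) = (\<Sum>j\<in>J. (a j)\<^sup>2 * (\<Sum>i\<in>J - {j}. a i))"
      by (simp add: sum_subtractf sum_distrib_left)
    also have "\<dots> = (\<Sum>j\<in>J. (a j)\<^sup>2 * A k - (a j) ^ 3)"
    proof (intro sum.cong refl)
      fix j assume "j \<in> J"
      then have "A k = a j + (\<Sum>i\<in>J - {j}. a i)"
        unfolding A_def a_def using fin by (intro sum.remove) auto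
      then show "(a j)\<^sup>2 * (\<Sum>i\<in>J - {j}. a i) = (a j)\<^sup>2 * A k - (a j) ^ 3"
        by (simp add: distrib_left power2_eq_square power3_eq_cube)
    qed
    finally show ?thesis
      unfolding sum_subtractf sum_distrib_right[symmetric] P_def Q_def by (simp add: mult.commute)
  qed
  \<comment> \<open>The pole \<open>l = k\<close> contributes \<open>- (a j)^3\<close>, hence
    \<open>- Q\<close>. For the other poles partial fractions in \<open>x j\<close> isolate
    \<open>1 / (y l - x j) - a j\<close>, whose sum over \<open>j\<close> is
    \<open>A l - A k\<close>.\<close>
  have xy: "(\<Sum>j\<in>J. (a j)\<^sup>2 * (\<Sum>l\<in>M. 1 / (x j - y l))) = B * P - R - Q"
  proof -
    have "(\<Sum>j\<in>J. (a j)\<^sup>2 * (\<Sum>l\<in>M. 1 / (x j - y l)))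
      = (\<Sum>j\<in>J. (\<Sum>l\<in>M - {k}. b l * (a j)\<^sup>2 - (b l)\<^sup>2 * (1 / (y l - x j) - a j)) - (a j) ^ 3)"
    proof (intro sum.cong refl)
      fix j assume j: "j \<in> J"
      have "(a j)\<^sup>2 * (1 / (x j - y k)) = - ((a j) ^ 3)"
        unfolding a_def by (simp add: power2_eq_square power3_eq_cube)
          (metis minus_diff_eq minus_divide_right mult_minus_right)
      moreover have "(\<Sum>l\<in>M - {k}. (a j)\<^sup>2 * (1 / (x j - y l))) =
          (\<Sum>l\<in>M - {k}. b l * (a j)\<^sup>2 - (b l)\<^sup>2 * (1 / (y l - x j) - a j))"
      proof (intro sum.cong refl)
        fix l assume "l \<in> M - {k}"
        then have "y k \<noteq> y l" "y k \<noteq> x j" "y l \<noteq> x j" using inj k j by (auto simp: inj_on_def)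
        then show "(a j)\<^sup>2 * (1 / (x j - y l)) = b l * (a j)\<^sup>2 - (b l)\<^sup>2 * (1 / (y l - x j) - a j)"
          unfolding a_def b_def by (simp add: divide_simps) (simp add: power2_eq_square algebra_simps)
      qed
      ultimately show "(a j)\<^sup>2 * (\<Sum>l\<in>M. 1 / (x j - y l)) =
          (\<Sum>l\<in>M - {k}. b l * (a j)\<^sup>2 - (b l)\<^sup>2 * (1 / (y l - x j) - a j)) - (a j) ^ 3"
        by (simp only: sum.remove[OF fin(2) k] distrib_left sum_distrib_left uminus_add_conv_diff)
    qed
    also have "\<dots> = (\<Sum>l\<in>M - {k}. \<Sum>j\<in>J. b l * (a j)\<^sup>2 - (b l)\<^sup>2 * (1 / (y l - x j) - a j)) - Q"
      by (simp add: sum_subtractf Q_def sum.swap[of _ J])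
    also have "\<dots> = (\<Sum>l\<in>M - {k}. b l * P - (b l)\<^sup>2 * (A l - A k)) - Q"
      by (simp add: sum_subtractf sum_distrib_left[symmetric] P_def A_def a_def)
    finally show ?thesis
      by (simp add: sum_subtractf sum_distrib_right[symmetric] B_def R_def)
  qed
  have "(\<Sum>j\<in>J. (2 * A k - v j) / (y k - x j)\<^sup>2) = (\<Sum>j\<in>J. 2 * A k * (a j)\<^sup>2
      - 4 * ((a j)\<^sup>2 * (\<Sum>i\<in>J - {j}. 1 / (x j - x i))) + 4 * ((a j)\<^sup>2 * (\<Sum>l\<in>M. 1 / (x j - y l))))"
    by (intro sum.cong refl) (simp add: v_def a_def power_divide diff_divide_distrib right_diff_distrib)
  also have "\<dots> = 2 * A k * P - 4 * (A k * P - Q) + 4 * (B * P - R - Q)"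
    by (simp only: sum.distrib sum_subtractf sum_distrib_left[symmetric] xx xy P_def[symmetric])
  finally have 1: "(\<Sum>j\<in>J. (2 * A k - v j) / (y k - x j)\<^sup>2) = 2 * A k * P - 4 * (A k * P - Q) + 4 * (B * P - R - Q)" .
  have 2: "(\<Sum>l\<in>M - {k}. 2 * (2 * A k - 2 * A l) / (y k - y l)\<^sup>2) = - 4 * R"
    unfolding R_def sum_distrib_left
    by (intro sum.cong refl) (simp add: b_def power_divide diff_divide_distrib right_diff_distrib)
  have 3: "(\<Sum>l\<in>M - {k}. 2 / (y k - y l)) = 2 * B"
    unfolding B_def sum_distrib_left by (simp add: b_def)
  have 4: "(\<Sum>j\<in>J. 1 / (y k - x j)\<^sup>2) = P"
    by (simp add: P_def a_def power_divide)
  show ?thesis unfolding 1 2 3 4 by (simp add: algebra_simps)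
qed

section \<open>The Calogero-Moser Hamiltonian and its partial derivatives\<close>

lemma sum_pairs_eq_half:
  fixes f :: "nat \<Rightarrow> nat \<Rightarrow> 'a :: field_char_0"
  assumes "\<And>j k. f j k = f k j"
  shows "(\<Sum>j=1..n. \<Sum>k\<in>{j<..n}. f j k) = (\<Sum>j=1..n. \<Sum>k\<in>{1..n} - {j}. f j k) / 2"
proof -
  have "(\<Sum>j=1..n. \<Sum>k\<in>{1..n} - {j}. f j k)
      = (\<Sum>j=1..n. (\<Sum>k\<in>{j<..n}. f j k) + (\<Sum>k\<in>{k\<in>{1..n}. k < j}. f j k))"
    by (intro sum.cong refl, subst sum.union_disjoint[symmetric]) (auto intro!: sum.cong)
  also have "\<dots> = (\<Sum>j=1..n. \<Sum>k\<in>{j<..n}. f j k) + (\<Sum>k=1..n. \<Sum>j\<in>{j\<in>{1..n}. k < j}. f j k)"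
    by (simp only: sum.distrib sum.swap_restrict[of "{1..n}" "{1..n}" f "\<lambda>j k. k < j"] finite_atLeastAtMost)
  also have "(\<Sum>k=1..n. \<Sum>j\<in>{j\<in>{1..n}. k < j}. f j k) = (\<Sum>j=1..n. \<Sum>k\<in>{j<..n}. f j k)"
    by (intro sum.cong) (auto simp: assms)
  finally show ?thesis by simp
qed

text \<open>Ordered pairs halve the coupling 16. This form is symmetric in the indices and matches
  the sum in \<open>stationary_energy\<close>.\<close>

lemma calogero_moser_hamiltonian_eq:
  "calogero_moser_hamiltonian n x p =
    (\<Sum>j=1..n. (p j)\<^sup>2 / 2) - 8 * (\<Sum>j=1..n. \<Sum>k\<in>{1..n} - {j}. 1 / (x j - x k)\<^sup>2)"
proof -
  have "(\<Sum>j=1..n. \<Sum>k\<in>{j<..n}. 16 / (x j - x k)\<^sup>2)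
      = (\<Sum>j=1..n. \<Sum>k\<in>{1..n} - {j}. 16 / (x j - x k)\<^sup>2) / 2"
    by (rule sum_pairs_eq_half) (simp add: power2_commute)
  then show ?thesis
    by (simp add: calogero_moser_hamiltonian_def sum_distrib_left sum_divide_distrib)
qed

lemma calogero_moser_deriv_momentum:
  assumes j: "j \<in> {1..n}"
  shows "((\<lambda>s. calogero_moser_hamiltonian n x (p(j := s))) has_real_derivative p j) (at (p j))"
proof -
  define c where "c = calogero_moser_hamiltonian n x p - (p j)\<^sup>2 / 2"
  have "(\<Sum>i=1..n. ((p(j := s)) i)\<^sup>2 / 2) = s\<^sup>2 / 2 + (\<Sum>i\<in>{1..n} - {j}. (p i)\<^sup>2 / 2)" for s
    using sum.remove[OF finite_atLeastAtMost j, of "\<lambda>i. ((p(j := s)) i)\<^sup>2 / 2"] by simp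
  from this this[of "p j"]
  have "calogero_moser_hamiltonian n x (p(j := s)) = s\<^sup>2 / 2 + c" for s
    unfolding calogero_moser_hamiltonian_def c_def by simp
  then show ?thesis by (auto intro!: derivative_eq_intros)
qed

text \<open>Each partner \<open>k\<close> of \<open>j\<close> occurs in two ordered pairs, and
  oddness of the cube makes their contributions equal: 8 * 2 * 2 = 32.\<close>

lemma calogero_moser_deriv_position:
  assumes inj: "inj_on x {1..n}" and j: "j \<in> {1..n}"
  shows "((\<lambda>s. calogero_moser_hamiltonian n (x(j := s)) p) has_real_derivative
    (\<Sum>k\<in>{1..n} - {j}. 32 / (x j - x k) ^ 3)) (at (x j))"
proof -
  \<comment> \<open>As the derivative of the \<open>i\<close>-th coordinate in the varied one,
    \<open>\<delta> i\<close> gives one formula for all pairs, whether or not they involve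
    \<open>j\<close>.\<close>
  define \<delta> :: "nat \<Rightarrow> real" where "\<delta> i = (if i = j then 1 else 0)" for i
  define G where "G i k = 2 / (x i - x k) ^ 3" for i k
  have \<delta>: "((\<lambda>s. (x(j := s)) i) has_real_derivative \<delta> i) (at (x j))" for i
    by (auto simp: \<delta>_def)
  have "((\<lambda>s. 1 / ((x(j := s)) i - (x(j := s)) k)\<^sup>2) has_real_derivative - ((\<delta> i - \<delta> k) * G i k)) (at (x j))"
    if "i \<in> {1..n}" "k \<in> {1..n} - {i}" for i k
  proof -
    have ne: "x i - x k \<noteq> 0" using inj_onD[OF inj, of i k] that by auto
    define u where "u s = (x(j := s)) i - (x(j := s)) k" for s
    have u: "(u has_real_derivative \<delta> i - \<delta> k) (at (x j))" "u (x j) = x i - x k"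
      unfolding u_def by (intro DERIV_diff \<delta>) simp
    have "((\<lambda>s. 1 / (u s)\<^sup>2) has_real_derivative - ((\<delta> i - \<delta> k) * G i k)) (at (x j))"
      using ne u(2) by (auto intro!: derivative_eq_intros u(1)
          simp: G_def divide_simps power2_eq_square power3_eq_cube)
    then show ?thesis by (simp only: u_def)
  qed
  then have "((\<lambda>s. calogero_moser_hamiltonian n (x(j := s)) p) has_real_derivative
     0 - 8 * (\<Sum>i=1..n. \<Sum>k\<in>{1..n} - {i}. - ((\<delta> i - \<delta> k) * G i k))) (at (x j))"
    unfolding calogero_moser_hamiltonian_eq
    by (intro DERIV_diff DERIV_const DERIV_cmult DERIV_sum) auto
  also have "0 - 8 * (\<Sum>i=1..n. \<Sum>k\<in>{1..n} - {i}. - ((\<delta> i - \<delta> k) * G i k))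
    = 8 * ((\<Sum>i=1..n. \<Sum>k\<in>{1..n} - {i}. \<delta> i * G i k) - (\<Sum>i=1..n. \<Sum>k\<in>{1..n} - {i}. \<delta> k * G i k))"
    by (simp add: sum_negf sum_subtractf left_diff_distrib)
  also have "(\<Sum>i=1..n. \<Sum>k\<in>{1..n} - {i}. \<delta> k * G i k) = (\<Sum>i=1..n. \<Sum>k\<in>{1..n} - {i}. \<delta> i * G k i)"
    by (rule sum_off_diagonal_swap) simp
  also have "\<dots> = - (\<Sum>i=1..n. \<Sum>k\<in>{1..n} - {i}. \<delta> i * G i k)"
  proof -
    have cube: "(x k - x i) ^ 3 = - ((x i - x k) ^ 3)" for i k
      using power_minus_odd[of 3 "x i - x k"] by simp
    have "\<delta> i * G k i = - (\<delta> i * G i k)" for i k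
      unfolding G_def cube[of k i] by simp
    then show ?thesis by (simp only: sum_negf)
  qed
  also have "(\<Sum>i=1..n. \<Sum>k\<in>{1..n} - {i}. \<delta> i * G i k) = (\<Sum>k\<in>{1..n} - {j}. G j k)"
    unfolding sum_distrib_left[symmetric] using j
    by (simp add: \<delta>_def if_distrib[of "\<lambda>c. c * _"] cong: if_cong)
  also have "8 * ((\<Sum>k\<in>{1..n} - {j}. G j k) - - (\<Sum>k\<in>{1..n} - {j}. G j k)) = (\<Sum>k\<in>{1..n} - {j}. 32 / (x j - x k) ^ 3)"
    by (simp add: G_def sum_distrib_left)
  finally show ?thesis .
qed

section \<open>The SLE(0) system: propagation of stationarity, second derivatives, reality and
  energy\<close>

theorem theorem4p2:
  fixes n m :: nat and T :: real
    and x0 :: "nat \<Rightarrow> real" and \<xi>0 :: "nat \<Rightarrow> complex"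
    and g :: "real \<Rightarrow> complex \<Rightarrow> complex"
    and x :: "nat \<Rightarrow> real \<Rightarrow> real" and \<xi> :: "nat \<Rightarrow> real \<Rightarrow> complex"
  assumes "0 < T"
    and "inj_on x0 {1..n}"
    and "cnj ` (\<xi>0 ` {1..m}) = \<xi>0 ` {1..m}"
    and "stationary_relations n m x0 \<xi>0"
    and "multiple_chordal_SLE0 n m T x0 \<xi>0 g x \<xi>"
  shows
    "(\<forall>t\<in>{0..<T}.
        (\<forall>j\<in>{1..n}.
          ((\<lambda>s. complex_of_real (x j s)) has_vector_derivative
             2 * ((\<Sum>k\<in>{1..n} - {j}. 2 / complex_of_real (x j t - x k t))
                  - (\<Sum>k=1..m. 2 / (complex_of_real (x j t) - \<xi> k t))))
            (at t within {0..<T})) \<and>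
        (\<forall>k\<in>{1..m}.
          (\<xi> k has_vector_derivative
             2 * (- (\<Sum>l\<in>{1..m} - {k}. 2 / (\<xi> k t - \<xi> l t))
                  + (\<Sum>j=1..n. 2 / (\<xi> k t - complex_of_real (x j t)))))
            (at t within {0..<T})))
     \<and>
     (hamilton_equations (calogero_moser_hamiltonian n) n T x (\<lambda>j. time_derivative T (x j)) \<and>
      (\<forall>t\<in>{0..<T}. \<forall>j\<in>{1..n}.
        (time_derivative T (x j) has_vector_derivative
           - (\<Sum>k\<in>{1..n} - {j}. 32 / (x j t - x k t) ^ 3))
          (at t within {0..<T})))
     \<and>
     (\<forall>t\<in>{0..<T}. \<forall>k\<in>{1..m}.
        (time_derivative T (\<xi> k) has_vector_derivative
           - (\<Sum>l\<in>{1..m} - {k}. 32 / (\<xi> k t - \<xi> l t) ^ 3))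
          (at t within {0..<T}))
     \<and>
     (\<forall>t\<in>{0..<T}.
        calogero_moser_hamiltonian n (\<lambda>j. x j t) (\<lambda>j. time_derivative T (x j) t) = 0)"
proof -
  define S where "S = {0..<T}"
  define J where "J = {1..n}"
  define M where "M = {1..m}"
  have fin: "finite J" "finite M" by (simp_all add: J_def M_def)
  note sle = assms(5)[unfolded multiple_chordal_SLE0_def, folded S_def J_def M_def]
  have collision: "collision_free n m (\<lambda>j. x j t) (\<lambda>k. \<xi> k t)" if "t \<in> S" for t
    using sle that by blast
  define X where "X j t = complex_of_real (x j t)" for j t
  have inj: "inj_on (\<lambda>j. X j t) J" "inj_on (\<lambda>k. \<xi> k t) M"
      "\<And>j k. j \<in> J \<Longrightarrow> k \<in> M \<Longrightarrow> \<xi> k t \<noteq> X j t" and injx: "inj_on (\<lambda>j. x j t) J"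
    if "t \<in> S" for t
    using collision[OF that]
    unfolding collision_free_def X_def J_def[symmetric] M_def[symmetric] inj_on_def of_real_eq_iff
    by blast+
  \<comment> \<open>Half the Loewner velocity of a pole; together with the drift \<open>v\<close> it
    has the form required by \<open>stationary_drift\<close>.\<close>
  define A where "A k t = (\<Sum>j\<in>J. 1 / (\<xi> k t - X j t))" for k t
  define v where "v j t = 4 * ((\<Sum>i\<in>J - {j}. 1 / (X j t - X i t)) - (\<Sum>l\<in>M. 1 / (X j t - \<xi> l t)))" for j t
  have dX: "(X j has_vector_derivative v j t) (at t within S)" if "j \<in> J" "t \<in> S" for j t
  proof -
    have "(X j has_vector_derivative ((\<Sum>k\<in>J - {j}. 2 / complex_of_real (x j t - x k t))
             - 2 * (\<Sum>l\<in>M. 2 / (complex_of_real (x j t) - \<xi> l t)))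
           + (\<Sum>k\<in>J - {j}. 2 / complex_of_real (x j t - x k t))) (at t within S)"
      unfolding X_def using sle that by blast
    then show ?thesis
      by (rule has_vector_derivative_eq_rhs)
        (simp add: v_def X_def right_diff_distrib sum_distrib_left sum.distrib[symmetric])
  qed
  have flow: "\<xi> k 0 = \<xi>0 k \<and> (\<forall>t\<in>S. (\<xi> k has_vector_derivative 2 * A k t) (at t within S))"
    if "k \<in> M" for k
  proof -
    have \<xi>: "\<xi> k t = g t (\<xi>0 k)" if "t \<in> S" for t
      using sle that \<open>k \<in> M\<close> by blast
    \<comment> \<open>No pole is swallowed before \<open>T\<close>, so the flow is prescribed at
      \<open>\<xi>0 k\<close> on all of [0,T).\<close>
    have sol: "loewner_solution n x T (\<xi>0 k) (\<lambda>t. g t (\<xi>0 k))"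
      using sle \<open>0 < T\<close> that unfolding loewner_flow_def by blast
    have "(\<xi> k has_vector_derivative 2 * A k t) (at t within S)" if t: "t \<in> S" for t
    proof (rule has_vector_derivative_transform[OF t \<xi>])
      have "((\<lambda>t. g t (\<xi>0 k)) has_vector_derivative
          (\<Sum>j\<in>J. 2 / (g t (\<xi>0 k) - complex_of_real (x j t)))) (at t within S)"
        using sol t unfolding loewner_solution_def S_def J_def by blast
      then show "((\<lambda>t. g t (\<xi>0 k)) has_vector_derivative 2 * A k t) (at t within S)"
        by (simp add: A_def X_def \<xi>[OF t] sum_distrib_left)
    qed
    moreover have "\<xi> k 0 = \<xi>0 k"
      using sol \<xi>[of 0] \<open>0 < T\<close> by (simp add: loewner_solution_def S_def)
    ultimately show ?thesis by blast
  qed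
  then have d\<xi>: "(\<xi> k has_vector_derivative 2 * A k t) (at t within S)" if "k \<in> M" "t \<in> S" for k t
    using that by blast
  have stationary: "(\<Sum>j\<in>J. 1 / (\<xi> k t - X j t)) = 2 * (\<Sum>l\<in>M - {k}. 1 / (\<xi> k t - \<xi> l t))"
    if k: "k \<in> M" and t: "t \<in> S" for k t
  proof -
    define s where "s t = - (\<Sum>j\<in>J. 1 / (\<xi> k t - X j t)) + (\<Sum>l\<in>M - {k}. 2 / (\<xi> k t - \<xi> l t))" for t
    \<comment> \<open>The coefficient supplied by \<open>stationary_drift\<close>; it is continuous
      because poles and particles do not meet.\<close>
    define c where "c t = 2 * (\<Sum>j\<in>J. 1 / (\<xi> k t - X j t)\<^sup>2)" for t
    have "s t = 0"
    proof (rule linear_ode_zero[where c = c and T = T, folded S_def, OF _ _ _ t])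
      have "continuous_on S (X j)" if "j \<in> J" for j
        using dX[OF that] by (rule continuous_on_vector_derivative)
      moreover have "continuous_on S (\<xi> k)"
        using d\<xi>[OF k] by (rule continuous_on_vector_derivative)
      ultimately show "continuous_on S c"
        unfolding c_def using inj(3) k by (intro continuous_intros) auto
    next
      show "s 0 = 0"
      proof -
        have "X j 0 = complex_of_real (x0 j)" if "j \<in> J" for j
          using sle that by (simp add: X_def)
        moreover have "\<xi> l 0 = \<xi>0 l" if "l \<in> M" for l
          using flow[OF that] by blast
        ultimately show ?thesis
          using assms(4)[unfolded stationary_relations_def, folded J_def M_def] k
          by (simp add: s_def)
      qed
    next
      fix t assume t: "t \<in> S"
      have "(s has_vector_derivative - (\<Sum>j\<in>J. - (1 * (2 * A k t - v j t) / (\<xi> k t - X j t)\<^sup>2))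
          + (\<Sum>l\<in>M - {k}. - (2 * (2 * A k t - 2 * A l t) / (\<xi> k t - \<xi> l t)\<^sup>2))) (at t within S)"
        unfolding s_def
      proof (intro has_vector_derivative_add has_vector_derivative_minus has_vector_derivative_sum
          has_vector_derivative_const_divide has_vector_derivative_diff dX d\<xi> k t)
        show "\<xi> k t - X j t \<noteq> 0" if "j \<in> J" for j
          using inj(3)[OF t that k] by simp
        show "l \<in> M" "\<xi> k t - \<xi> l t \<noteq> 0" if "l \<in> M - {k}" for l
          using inj(2)[OF t] that k by (auto simp: inj_on_def)
      qed
      also have "- (\<Sum>j\<in>J. - (1 * (2 * A k t - v j t) / (\<xi> k t - X j t)\<^sup>2))
          + (\<Sum>l\<in>M - {k}. - (2 * (2 * A k t - 2 * A l t) / (\<xi> k t - \<xi> l t)\<^sup>2)) = c t * s t"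
        using stationary_drift[OF fin k inj[OF t]]
        by (simp add: sum_negf c_def s_def A_def v_def)
      finally show "(s has_vector_derivative c t * s t) (at t within S)" .
    qed
    then show ?thesis by (simp add: s_def sum_distrib_left)
  qed

  define z where "z = case_sum X \<xi>"
  define F where "F i t = log_gas_field (J <+> M) signed_charge (\<lambda>i. z i t) i" for i t
  have z_at: "(\<lambda>i. z i t) = case_sum (\<lambda>j. X j t) (\<lambda>k. \<xi> k t)" for t
    by (auto simp: z_def fun_eq_iff split: sum.split)
  have Fl: "4 * F (Inl j) t = v j t" for j t
    by (simp add: F_def z_at log_gas_field_signed[OF fin] v_def)
  \<comment> \<open>Stationarity makes the pole sum half of \<open>A k t\<close>, so the gas
    velocity and the Loewner velocity coincide.\<close>
  have Fr: "4 * F (Inr k) t = 2 * A k t" if "k \<in> M" "t \<in> S" for k t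
    using stationary[OF that] by (simp add: F_def z_at log_gas_field_signed[OF fin] A_def)
  have dz: "(z i has_vector_derivative 4 * F i t) (at t within S)" if "i \<in> J <+> M" "t \<in> S" for i t
    using that dX d\<xi> by (auto simp: z_def Fl Fr)
  have dF: "((\<lambda>s. 4 * F a s) has_vector_derivative
      - (\<Sum>b\<in>{b \<in> (J <+> M) - {a}. signed_charge b = (signed_charge a :: complex)}.
          32 / (z a t - z b t) ^ 3)) (at t within S)" if "a \<in> J <+> M" "t \<in> S" for a t
    unfolding F_def
  proof (rule log_gas_second_order)
    show "inj_on (\<lambda>i. z i t) (J <+> M)" if "t \<in> S" for t
      unfolding z_at by (intro inj_on_case_sum_Plus inj that)
  qed (use fin that dz in \<open>auto simp: F_def\<close>)
  have same_l: "{b \<in> (J <+> M) - {Inl j}. signed_charge b = (1 :: complex)} = Inl ` (J - {j})" for j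
    by auto
  have same_r: "{b \<in> (J <+> M) - {Inr k}. signed_charge b = (- 1 :: complex)} = Inr ` (M - {k})" for k
    by auto
  have dv: "(v j has_vector_derivative - (\<Sum>i\<in>J - {j}. 32 / (X j t - X i t) ^ 3)) (at t within S)"
    if "j \<in> J" "t \<in> S" for j t
    using dF[OF InlI[OF that(1)] that(2), unfolded signed_charge_simps same_l Fl]
    by (simp add: sum.reindex z_def)
  have d2\<xi>: "((\<lambda>s. 2 * A k s) has_vector_derivative - (\<Sum>l\<in>M - {k}. 32 / (\<xi> k t - \<xi> l t) ^ 3)) (at t within S)"
    if "k \<in> M" "t \<in> S" for k t
    using has_vector_derivative_transform[OF that(2) Fr[OF that(1), symmetric]
        dF[OF InrI[OF that(1)] that(2), unfolded signed_charge_simps same_r]]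
    by (simp add: sum.reindex z_def)

  \<comment> \<open>No point of [0,T) is isolated, so derivatives within it are unique, including
    the one-sided one at 0.\<close>
  have not_bot: "at t within S \<noteq> bot" if "t \<in> S" for t
    using that \<open>0 < T\<close> by (simp add: S_def trivial_limit_within)
  define p where "p j t = Re (v j t)" for j t
  have dx: "(x j has_vector_derivative p j t) (at t within S)" if "j \<in> J" "t \<in> S" for j t
    using bounded_linear.has_vector_derivative[OF bounded_linear_Re dX[OF that]] by (simp add: X_def p_def)
  \<comment> \<open>The drift is a priori complex, but it is the derivative of a real-valued
    function; uniqueness of the derivative makes it real.\<close>
  have v: "v j t = complex_of_real (p j t)" if "j \<in> J" "t \<in> S" for j t
  proof (rule vector_derivative_unique_within[OF not_bot[OF that(2)] dX[OF that]])
    show "(X j has_vector_derivative complex_of_real (p j t)) (at t within S)"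
      unfolding X_def by (rule bounded_linear.has_vector_derivative[OF bounded_linear_of_real dx[OF that]])
  qed
  have Dx: "time_derivative T (x j) t = p j t" if "j \<in> J" "t \<in> S" for j t
    using vector_derivative_within[OF not_bot dx] that by (simp add: S_def)
  have D\<xi>: "time_derivative T (\<xi> k) t = 2 * A k t" if "k \<in> M" "t \<in> S" for k t
    using vector_derivative_within[OF not_bot d\<xi>] that by (simp add: S_def)
  have ddx: "(time_derivative T (x j) has_vector_derivative - (\<Sum>k\<in>J - {j}. 32 / (x j t - x k t) ^ 3)) (at t within S)"
    if j: "j \<in> J" and t: "t \<in> S" for j t
  proof (rule has_vector_derivative_transform[OF t Dx[OF j]])
    have "- (\<Sum>k\<in>J - {j}. 32 / (X j t - X k t) ^ 3)
        = complex_of_real (- (\<Sum>k\<in>J - {j}. 32 / (x j t - x k t) ^ 3))"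
      by (simp add: X_def)
    then show "(p j has_vector_derivative - (\<Sum>k\<in>J - {j}. 32 / (x j t - x k t) ^ 3)) (at t within S)"
      using bounded_linear.has_vector_derivative[OF bounded_linear_Re dv[OF j t]]
      unfolding p_def by (simp only: Re_complex_of_real)
  qed
  have dd\<xi>: "(time_derivative T (\<xi> k) has_vector_derivative - (\<Sum>l\<in>M - {k}. 32 / (\<xi> k t - \<xi> l t) ^ 3)) (at t within S)"
    if "k \<in> M" "t \<in> S" for k t
    using has_vector_derivative_transform[OF that(2) D\<xi>[OF that(1)] d2\<xi>[OF that]] .

  have closed_x: "((\<lambda>s. complex_of_real (x j s)) has_vector_derivative
      2 * ((\<Sum>k\<in>J - {j}. 2 / complex_of_real (x j t - x k t))
        - (\<Sum>k\<in>M. 2 / (complex_of_real (x j t) - \<xi> k t)))) (at t within S)"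
    if "j \<in> J" "t \<in> S" for j t
    using dX[OF that] unfolding X_def
    by (rule has_vector_derivative_eq_rhs) (simp add: v_def X_def right_diff_distrib sum_distrib_left)
  have closed_\<xi>: "(\<xi> k has_vector_derivative
      2 * (- (\<Sum>l\<in>M - {k}. 2 / (\<xi> k t - \<xi> l t))
        + (\<Sum>j\<in>J. 2 / (\<xi> k t - complex_of_real (x j t))))) (at t within S)"
    if "k \<in> M" "t \<in> S" for k t
  proof (rule has_vector_derivative_eq_rhs[OF d\<xi>[OF that]])
    have "(\<Sum>l\<in>M - {k}. 2 / (\<xi> k t - \<xi> l t)) = A k t"
      using stationary[OF that] by (simp add: A_def sum_distrib_left)
    moreover have "(\<Sum>j\<in>J. 2 / (\<xi> k t - complex_of_real (x j t))) = 2 * A k t"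
      by (simp add: A_def X_def sum_distrib_left)
    \<comment> \<open>The right-hand side is \<open>2 * (- A k t + 2 * A k t)\<close>.\<close>
    ultimately show "2 * A k t = 2 * (- (\<Sum>l\<in>M - {k}. 2 / (\<xi> k t - \<xi> l t))
        + (\<Sum>j\<in>J. 2 / (\<xi> k t - complex_of_real (x j t))))" by simp
  qed
  \<comment> \<open>The partial derivatives to exhibit are the momentum itself and the sum of
    \<open>32 / (x j t - x k t) ^ 3\<close>.\<close>
  have hamilton: "hamilton_equations (calogero_moser_hamiltonian n) n T x (\<lambda>j. time_derivative T (x j))"
    unfolding hamilton_equations_def S_def[symmetric]
  proof (intro ballI exI conjI)
    fix j t assume j: "j \<in> {1..n}" and t: "t \<in> S"
    have jJ: "j \<in> J" using j by (simp add: J_def)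
    show "((\<lambda>s. calogero_moser_hamiltonian n (\<lambda>i. x i t)
        ((\<lambda>i. vector_derivative (x i) (at t within S))(j := s))) has_real_derivative
        vector_derivative (x j) (at t within S)) (at (vector_derivative (x j) (at t within S)))"
      by (rule calogero_moser_deriv_momentum[OF j])
    show "((\<lambda>s. calogero_moser_hamiltonian n ((\<lambda>i. x i t)(j := s))
        (\<lambda>i. vector_derivative (x i) (at t within S))) has_real_derivative
        (\<Sum>k\<in>{1..n} - {j}. 32 / (x j t - x k t) ^ 3)) (at (x j t))"
      by (rule calogero_moser_deriv_position[OF injx[OF t, unfolded J_def] j])
    show "(x j has_vector_derivative vector_derivative (x j) (at t within S)) (at t within S)"
      using dx[OF jJ t] Dx[OF jJ t] by (simp add: S_def)
    show "((\<lambda>t. vector_derivative (x j) (at t within S)) has_vector_derivative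
        - (\<Sum>k\<in>{1..n} - {j}. 32 / (x j t - x k t) ^ 3)) (at t within S)"
      using ddx[OF jJ t] by (simp add: S_def J_def)
  qed
  have energy: "calogero_moser_hamiltonian n (\<lambda>j. x j t) (\<lambda>j. time_derivative T (x j) t) = 0"
    if t: "t \<in> S" for t
  proof -
    \<comment> \<open>The computation takes place in the complex numbers, where the poles live, and
      returns to the reals by injectivity of the embedding. Half of 16 = 4^2 is the factor 8 of
      \<open>calogero_moser_hamiltonian_eq\<close>.\<close>
    have "complex_of_real (\<Sum>j\<in>J. (p j t)\<^sup>2) = (\<Sum>j\<in>J. (v j t)\<^sup>2)"
      using t by (simp add: v)
    also have "\<dots> = 16 * (\<Sum>j\<in>J. ((\<Sum>i\<in>J - {j}. 1 / (X j t - X i t)) - (\<Sum>l\<in>M. 1 / (X j t - \<xi> l t)))\<^sup>2)"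
      unfolding v_def power_mult_distrib sum_distrib_left by simp
    also have "\<dots> = 16 * (\<Sum>j\<in>J. \<Sum>i\<in>J - {j}. 1 / (X j t - X i t)\<^sup>2)"
      by (subst stationary_energy[OF fin inj[OF t] stationary[OF _ t]]) auto
    also have "\<dots> = complex_of_real (16 * (\<Sum>j\<in>J. \<Sum>i\<in>J - {j}. 1 / (x j t - x i t)\<^sup>2))"
      by (simp add: X_def)
    finally have "(\<Sum>j\<in>J. (p j t)\<^sup>2) = 16 * (\<Sum>j\<in>J. \<Sum>i\<in>J - {j}. 1 / (x j t - x i t)\<^sup>2)"
      by (simp only: of_real_eq_iff)
    moreover have "(\<Sum>j\<in>J. (time_derivative T (x j) t)\<^sup>2 / 2) = (\<Sum>j\<in>J. (p j t)\<^sup>2) / 2"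
      using t by (simp add: Dx sum_divide_distrib)
    ultimately show ?thesis
      unfolding calogero_moser_hamiltonian_eq J_def[symmetric] by simp
  qed
  show ?thesis
    unfolding S_def[symmetric] J_def[symmetric] M_def[symmetric]
    using closed_x closed_\<xi> hamilton ddx dd\<xi> energy unfolding S_def by blast
qed

end
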